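(* Let $n>1$ and let $X$ be a tail$^+$ CKL-algebra of size $n$. If $X$ is simple, then $X$ is linear; hence $X$ is isomorphic to $\mathbf A_n$.
   Context: An L-algebra is a set $X$ with a binary operation $\cdot$ and a distinguished element $1$ such that for all $x,y,z\in X$: $1\cdot x=x$ and $x\cdot 1=x\cdot x=1$; $(x\cdot y)\cdot(x\cdot z)=(y\cdot x)\cdot(y\cdot z)$; and $x\cdot y=y\cdot x=1$ implies $x=y$. It is partially ordered by $x\le y\iff x\cdot y=1$; it is linear if this order is total. A CKL-algebra is an L-algebra with $x\cdot(y\cdot z)=y\cdot(x\cdot z)$ for all $x,y,z$. An L-subalgebra is a subset closed under the L-algebra operation. An ideal of $X$ is a nonempty subset $I\subseteq X$ such that for all $x\in I$, $y\in X$: (I1) $x\cdot y\in I$ implies $y\in I$; (I2) $y\cdot x\in I$; (I3) $(x\cdot y)\cdot y\in I$; (I4) $y\cdot(x\cdot y)\in I$. $X$ is simple if it has no ideals other than $\{1\}$ and $X$. An L-algebra $X$ has a tail if there is a minimal element $z$ of $X$ such that the upset $\{y\in X\mid y\ge z\}$ is totally ordered (this upset is called a tail). A finite L-algebra $X$ is a tail$^+$ L-algebra if it has a tail, or if it contains L-subalgebras $Y\subseteq Y_0\subseteq X$ such that: (1) $Y$ has a tail; (2) $Y_0\setminus Y=\{z_0\}$ consists of a single element, which is the smallest element of $Y_0$; (3) the complement $X\setminus Y$ is totally ordered. A tail$^+$ CKL-algebra is a CKL-algebra that is a tail$^+$ L-algebra. $\mathbf A_n$ is the L-algebra on the $n$-element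 set $\{a_0,\dots,a_{n-1}\}$ with $1=a_0$ and $a_i\cdot a_j=a_{\max(j-i,0)}$. *)

theory Defs
  imports Main
begin

locale l_algebra =
  fixes X :: "'a set"
    and dot :: "'a \<Rightarrow> 'a \<Rightarrow> 'a"
    and e :: 'a
  assumes unit_in [simp, intro]: "e \<in> X"
    and dot_in [simp, intro]: "\<lbrakk>x \<in> X; y \<in> X\<rbrakk> \<Longrightarrow> dot x y \<in> X"
    and unit_left: "x \<in> X \<Longrightarrow> dot e x = x"
    and unit_right: "x \<in> X \<Longrightarrow> dot x e = e"
    and dot_self: "x \<in> X \<Longrightarrow> dot x x = e"
    and cycloid: "\<lbrakk>x \<in> X; y \<in> X; z \<in> X\<rbrakk>
      \<Longrightarrow> dot (dot x y) (dot x z) = dot (dot y x) (dot y z)"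
    and dot_antisym: "\<lbrakk>x \<in> X; y \<in> X; dot x y = e; dot y x = e\<rbrakk> \<Longrightarrow> x = y"

locale ckl_algebra = l_algebra +
  assumes exchange: "\<lbrakk>x \<in> X; y \<in> X; z \<in> X\<rbrakk> \<Longrightarrow> dot x (dot y z) = dot y (dot x z)"

definition l_le :: "('a \<Rightarrow> 'a \<Rightarrow> 'a) \<Rightarrow> 'a \<Rightarrow> 'a \<Rightarrow> 'a \<Rightarrow> bool" where
  "l_le dot e x y \<longleftrightarrow> dot x y = e"

text \<open>On an L-algebra \<open>l_le\<close> is a partial order by the axioms, so being a total order only
  requires that distinct elements be comparable, which is \<open>totalp_on\<close>.\<close>

definition l_linear :: "'a set \<Rightarrow> ('a \<Rightarrow> 'a \<Rightarrow> 'a) \<Rightarrow> 'a \<Rightarrow> bool" where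
  "l_linear X dot e \<longleftrightarrow> totalp_on X (l_le dot e)"

definition l_subalgebra :: "'a set \<Rightarrow> 'a set \<Rightarrow> ('a \<Rightarrow> 'a \<Rightarrow> 'a) \<Rightarrow> bool" where
  "l_subalgebra Y X dot \<longleftrightarrow> Y \<subseteq> X \<and> (\<forall>x\<in>Y. \<forall>y\<in>Y. dot x y \<in> Y)"

definition l_ideal :: "'a set \<Rightarrow> 'a set \<Rightarrow> ('a \<Rightarrow> 'a \<Rightarrow> 'a) \<Rightarrow> bool" where
  "l_ideal I X dot \<longleftrightarrow> I \<noteq> {} \<and> I \<subseteq> X \<and>
    (\<forall>x\<in>I. \<forall>y\<in>X.
      (dot x y \<in> I \<longrightarrow> y \<in> I) \<and>
      dot y x \<in> I \<and>
      dot (dot x y) y \<in> I \<and>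
      dot y (dot x y) \<in> I)"

definition l_simple :: "'a set \<Rightarrow> ('a \<Rightarrow> 'a \<Rightarrow> 'a) \<Rightarrow> 'a \<Rightarrow> bool" where
  "l_simple X dot e \<longleftrightarrow> (\<forall>I. l_ideal I X dot \<longrightarrow> I = {e} \<or> I = X)"

definition has_tail :: "'a set \<Rightarrow> ('a \<Rightarrow> 'a \<Rightarrow> 'a) \<Rightarrow> 'a \<Rightarrow> bool" where
  "has_tail X dot e \<longleftrightarrow>
    (\<exists>z\<in>X. (\<forall>y\<in>X. l_le dot e y z \<longrightarrow> y = z) \<and>
           totalp_on {y \<in> X. l_le dot e z y} (l_le dot e))"

definition tail_plus :: "'a set \<Rightarrow> ('a \<Rightarrow> 'a \<Rightarrow> 'a) \<Rightarrow> 'a \<Rightarrow> bool" where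
  "tail_plus X dot e \<longleftrightarrow> finite X \<and>
    (has_tail X dot e \<or>
     (\<exists>Y Y0 z0. l_subalgebra Y X dot \<and> l_subalgebra Y0 X dot \<and> Y \<subseteq> Y0 \<and>
        has_tail Y dot e \<and>
        Y0 - Y = {z0} \<and> (\<forall>y\<in>Y0. l_le dot e z0 y) \<and>
        totalp_on (X - Y) (l_le dot e)))"

locale tail_plus_ckl_algebra = ckl_algebra +
  assumes tail_plus: "tail_plus X dot e"

definition l_isomorphic ::
  "'a set \<Rightarrow> ('a \<Rightarrow> 'a \<Rightarrow> 'a) \<Rightarrow> 'a \<Rightarrow> 'b set \<Rightarrow> ('b \<Rightarrow> 'b \<Rightarrow> 'b) \<Rightarrow> 'b \<Rightarrow> bool" where
  "l_isomorphic X dot e X' dot' e' \<longleftrightarrow>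
    (\<exists>f. bij_betw f X X' \<and> f e = e' \<and> (\<forall>x\<in>X. \<forall>y\<in>X. f (dot x y) = dot' (f x) (f y)))"

text \<open>The algebra $A_n$ is given by the indices of its elements: $a_i$ is the natural number
  \<open>i\<close>, the distinguished element is \<open>0\<close>, and truncated subtraction on \<^typ>\<open>nat\<close> is
  $\max(j - i, 0)$.\<close>

definition A_carrier :: "nat \<Rightarrow> nat set" where
  "A_carrier n = {..<n}"

definition A_dot :: "nat \<Rightarrow> nat \<Rightarrow> nat" where
  "A_dot i j = j - i"

lemma A_ckl_algebra: "n > 0 \<Longrightarrow> ckl_algebra (A_carrier n) A_dot 0"
  by unfold_locales (auto simp: A_carrier_def A_dot_def)

end

(* In a simple CKL-algebra p . q = q forces p = 1 or q = 1, because q is then outside the ideal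
   generated by p. For arbitrary x, z put v = (x . z) . z, so that x, z <= v and v . z = x . z. The
   cycloid equation for x <= v reads (v . x) . (x . z) = x . z; hence x <= z, or v <= x and then
   x = v >= z. So every simple CKL-algebra is linear, and x = (x . z) . z for z <= x. In the finite
   case u |-> u . y is thus an order-reversing involution of the upset of y, which maps the interval
   [y, x] onto the upset of x . y; counting elements shows that the rank of x . y is the
   difference of the ranks of y and x. *)

theory Submission
  imports Defs "HOL-Library.FuncSet"
begin

context l_algebra
begin

text \<open>With \<open>dot x y = e\<close> the left side of the cycloid equation collapses to
  \<open>dot x z\<close>, and with \<open>dot y z = e\<close> its right side collapses to
  \<open>e\<close>.\<close>

lemma le_trans:
  assumes "x \<in> X" "y \<in> X" "z \<in> X" "dot x y = e" "dot y z = e"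
  shows "dot x z = e"
  using cycloid[of x y z] assms by (simp add: unit_left unit_right)

lemma dot_mono_right:
  assumes "p \<in> X" "x \<in> X" "y \<in> X" "dot x y = e"
  shows "dot (dot p x) (dot p y) = e"
  using cycloid[of p x y] assms by (simp add: unit_right)

lemma funpow_dot_in: "p \<in> X \<Longrightarrow> x \<in> X \<Longrightarrow> (dot p ^^ k) x \<in> X"
  by (induction k) auto

lemma funpow_dot_unit: "p \<in> X \<Longrightarrow> (dot p ^^ k) e = e"
  by (induction k) (auto simp: unit_right)

lemma funpow_dot_mono:
  assumes "p \<in> X" "x \<in> X" "y \<in> X" "dot x y = e"
  shows "dot ((dot p ^^ k) x) ((dot p ^^ k) y) = e"
  using assms by (induction k) (auto simp: dot_mono_right funpow_dot_in)

end

context ckl_algebra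
begin

lemma le_dot: "x \<in> X \<Longrightarrow> y \<in> X \<Longrightarrow> dot x (dot y x) = e"
  using exchange[of x y x] by (simp add: dot_self unit_right)

lemma le_dot_dot: "x \<in> X \<Longrightarrow> y \<in> X \<Longrightarrow> dot x (dot (dot x y) y) = e"
  using exchange[of x "dot x y" y] by (simp add: dot_self)

text \<open>Exchange turns the claim into x \<le> (y . z) . z, which follows from x \<le> y \<le> (y
  . z) . z.\<close>

lemma dot_antimono_left:
  assumes "x \<in> X" "y \<in> X" "z \<in> X" "dot x y = e"
  shows "dot (dot y z) (dot x z) = e"
proof -
  have "dot x (dot (dot y z) z) = e"
    using le_trans[of x y "dot (dot y z) z"] le_dot_dot[of y z] assms by simp
  then show ?thesis
    using exchange[of "dot y z" x z] assms by simp
qed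

text \<open>The antitone map u |-> u . y forms a Galois connection with itself, so applying it three
  times equals applying it once.\<close>

lemma dot_dot_dot:
  assumes "x \<in> X" "y \<in> X"
  shows "dot (dot (dot x y) y) y = dot x y"
proof (rule dot_antisym)
  show "dot (dot (dot (dot x y) y) y) (dot x y) = e"
    using assms by (simp add: dot_antimono_left le_dot_dot)
  show "dot (dot x y) (dot (dot (dot x y) y) y) = e"
    using assms by (simp add: le_dot_dot)
qed (use assms in auto)

text \<open>Condition (I1) with the unit makes \<open>I\<close> upward closed; the elements in (I2)
  and (I3) lie above x, and the one in (I4) equals \<open>e\<close>.\<close>

lemma l_idealI:
  assumes "I \<subseteq> X" "e \<in> I"
    and mp: "\<And>x y. x \<in> I \<Longrightarrow> y \<in> X \<Longrightarrow> dot x y \<in> I \<Longrightarrow> y \<in> I"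
  shows "l_ideal I X dot"
proof -
  have up: "y \<in> I" if "x \<in> I" "y \<in> X" "dot x y = e" for x y
    using mp[of x y] that assms(2) by simp
  have "dot y x \<in> I" "dot (dot x y) y \<in> I" "dot y (dot x y) \<in> I"
    if "x \<in> I" "y \<in> X" for x y
  proof -
    have x: "x \<in> X" using that assms(1) by blast
    show "dot y x \<in> I" using up[of x "dot y x"] x that by (simp add: le_dot)
    show "dot (dot x y) y \<in> I" using up[of x "dot (dot x y) y"] x that by (simp add: le_dot_dot)
    show "dot y (dot x y) \<in> I" using x that assms(2) by (simp add: le_dot)
  qed
  then show ?thesis
    unfolding l_ideal_def using assms(1,2) by (auto intro: mp)
qed

lemma funpow_dot_exchange:
  assumes "p \<in> X" "x \<in> X" "y \<in> X"
  shows "(dot p ^^ k) (dot x y) = dot x ((dot p ^^ k) y)"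
  using assms by (induction k) (auto simp: funpow_dot_in exchange)

text \<open>Closure under (I1): exchange moves the m applications of p past x, giving x \<le> p^m y;
  applying p another k times sends x, and hence p^m y, to \<open>e\<close>.\<close>

lemma l_ideal_generated:
  assumes p: "p \<in> X"
  shows "l_ideal {y \<in> X. \<exists>k. (dot p ^^ k) y = e} X dot" (is "l_ideal ?I X dot")
proof (rule l_idealI)
  show "e \<in> ?I" by (auto intro: exI[of _ 0])
next
  fix x y assume "x \<in> ?I" "y \<in> X" "dot x y \<in> ?I"
  then obtain k m where x: "x \<in> X" and k: "(dot p ^^ k) x = e"
    and m: "(dot p ^^ m) (dot x y) = e" by blast
  have "dot x ((dot p ^^ m) y) = e"
    using m p x \<open>y \<in> X\<close> by (simp add: funpow_dot_exchange)
  then have "dot e ((dot p ^^ k) ((dot p ^^ m) y)) = e"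
    using funpow_dot_mono[of p x "(dot p ^^ m) y" k] k p x \<open>y \<in> X\<close>
    by (simp add: funpow_dot_in)
  then have "(dot p ^^ (k + m)) y = e"
    using p \<open>y \<in> X\<close> by (simp add: funpow_add unit_left funpow_dot_in)
  then show "y \<in> ?I" using \<open>y \<in> X\<close> by blast
qed auto

lemma simple_dot_fixed:
  assumes "l_simple X dot e" and p: "p \<in> X" and q: "q \<in> X" and fixed: "dot p q = q"
  shows "p = e \<or> q = e"
proof -
  define I where "I = {y \<in> X. \<exists>k. (dot p ^^ k) y = e}"
  \<comment> \<open>A fixed point of p is never moved to \<open>e\<close> by iteration, unless it is
    \<open>e\<close> already.\<close>
  have "(dot p ^^ k) q = q" for k
    using fixed by (induction k) auto
  then have "q \<in> I \<Longrightarrow> q = e" unfolding I_def by auto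
  moreover have "p \<in> I"
    unfolding I_def using p by (auto simp: dot_self intro!: exI[of _ 1])
  moreover have "I = {e} \<or> I = X"
    using assms(1) l_ideal_generated[OF p] unfolding l_simple_def I_def by blast
  ultimately show ?thesis using q by blast
qed

lemma simple_le_or_involutive:
  assumes "l_simple X dot e" and x: "x \<in> X" and z: "z \<in> X"
  shows "dot x z = e \<or> dot (dot x z) z = x"
proof -
  let ?v = "dot (dot x z) z"
  have "dot (dot ?v x) (dot x z) = dot x z"
    using cycloid[of ?v x z] x z by (simp add: dot_dot_dot le_dot_dot unit_left)
  then have "dot ?v x = e \<or> dot x z = e"
    using simple_dot_fixed[OF assms(1), of "dot ?v x" "dot x z"] x z by simp
  then show ?thesis
    using dot_antisym[of ?v x] le_dot_dot[OF x z] x z by auto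
qed

lemma simple_linear:
  assumes "l_simple X dot e"
  shows "l_linear X dot e"
proof -
  have "dot x z = e \<or> dot z x = e" if "x \<in> X" "z \<in> X" for x z
    using simple_le_or_involutive[OF assms that] le_dot[of z "dot x z"] that by auto
  then show ?thesis
    unfolding l_linear_def l_le_def totalp_on_def by blast
qed

text \<open>The dichotomy says nothing when x \<le> z, but then x = z by antisymmetry.\<close>

lemma simple_involutive:
  assumes "l_simple X dot e" "x \<in> X" "z \<in> X" "dot z x = e"
  shows "dot (dot x z) z = x"
proof (cases "dot x z = e")
  case True
  then have "x = z" using dot_antisym assms by blast
  then show ?thesis using assms by (simp add: dot_self unit_left)
next
  case False
  then show ?thesis using simple_le_or_involutive assms by blast
qed

text \<open>The map is its own inverse: both sets lie above y, where it is an involution.\<close>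

lemma simple_bij_betw_interval:
  assumes S: "l_simple X dot e" and x: "x \<in> X" and y: "y \<in> X" and yx: "dot y x = e"
  shows "bij_betw (\<lambda>u. dot u y) {u \<in> X. dot y u = e \<and> dot u x = e} {w \<in> X. dot (dot x y) w = e}"
    (is "bij_betw _ ?A ?B")
proof (rule bij_betwI[where g = "\<lambda>w. dot w y"])
  have above: "dot y w = e" if "w \<in> ?B" for w
    using le_trans[of y "dot x y" w] le_dot[of y x] that x y by auto
  show "(\<lambda>u. dot u y) \<in> ?A \<rightarrow> ?B"
    using x y by (simp add: dot_antimono_left)
  show "(\<lambda>w. dot w y) \<in> ?B \<rightarrow> ?A"
  proof
    fix w assume w: "w \<in> ?B"
    \<comment> \<open>The upper bound (x . y) . y equals x by involutivity, so w . y \<le>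
      x.\<close>
    have "dot (dot w y) (dot (dot x y) y) = e"
      using w x y by (intro dot_antimono_left) auto
    then show "dot w y \<in> ?A"
      using w x y le_dot[of y w] simple_involutive[OF S x y yx] by auto
  qed
  show "dot (dot u y) y = u" if "u \<in> ?A" for u
    using simple_involutive[OF S _ y] that by blast
  show "dot (dot w y) y = w" if "w \<in> ?B" for w
    using simple_involutive[OF S _ y] above that by blast
qed

lemma finite_simple_isomorphic:
  assumes fin: "finite X" and S: "l_simple X dot e"
  shows "l_isomorphic X dot e (A_carrier (card X)) A_dot 0"
proof -
  define up where "up x = {u \<in> X. dot x u = e}" for x
  \<comment> \<open>The rank counts the elements strictly above x, so the unit gets index 0.\<close>
  define f where "f x = card (up x) - 1" for x
  \<comment> \<open>\<open>totalp_on\<close> only compares distinct elements;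
    \<open>dot_self\<close> covers x = y.\<close>
  have lin: "dot x y = e \<or> dot y x = e" if "x \<in> X" "y \<in> X" for x y
    using simple_linear[OF S] that dot_self[of x]
    unfolding l_linear_def l_le_def totalp_on_def by metis
  have fin_up: "finite (up x)" for x
    using fin by (simp add: up_def)
  have self_up: "x \<in> up x" if "x \<in> X" for x
    using that by (simp add: up_def dot_self)
  have card_up: "card (up x) = Suc (f x)" if "x \<in> X" for x
    using self_up[OF that] fin_up[of x] card_gt_0_iff[of "up x"] unfolding f_def by auto
  have up_mono: "up x \<subseteq> up y" if "x \<in> X" "y \<in> X" "dot y x = e" for x y
    using le_trans[of y x] that unfolding up_def by blast
  have f_antimono: "f x \<le> f y" if "x \<in> X" "y \<in> X" "dot y x = e" for x y
    using card_mono[OF fin_up up_mono[OF that]] unfolding f_def by simp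
  have f_strict: "x = y" if "x \<in> X" "y \<in> X" "dot y x = e" "f x = f y" for x y
  proof -
    have "up x = up y"
      using card_subset_eq[OF fin_up up_mono[OF that(1-3)]] card_up that by simp
    then show ?thesis
      using self_up[of y] dot_antisym[of x y] that by (auto simp: up_def)
  qed
  have "inj_on f X"
    by (intro inj_onI) (metis f_strict lin)
  moreover have "f ` X \<subseteq> {..<card X}"
  proof
    fix i assume "i \<in> f ` X"
    then obtain x where "x \<in> X" "i = f x" by blast
    then show "i \<in> {..<card X}"
      using card_mono[OF fin, of "up x"] card_up[of x] by (auto simp: up_def)
  qed
  ultimately have bij: "bij_betw f X (A_carrier (card X))"
    unfolding bij_betw_def A_carrier_def
    using card_subset_eq[of "{..<card X}" "f ` X"] by (simp add: card_image)
  have "up e = {e}" by (auto simp: up_def unit_left unit_right)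
  then have f_unit: "f e = 0" by (simp add: f_def)
  have "f (dot x y) = f y - f x" if x: "x \<in> X" and y: "y \<in> X" for x y
  proof (cases "dot x y = e")
    \<comment> \<open>Here f y \<le> f x, so the truncated difference is 0, the rank of
      \<open>e\<close>.\<close>
    case True
    then show ?thesis using f_antimono[of y x] x y f_unit by simp
  next
    case False
    then have yx: "dot y x = e" using lin x y by blast
    let ?A = "{u \<in> X. dot y u = e \<and> dot u x = e}"
    \<comment> \<open>By linearity the upset of y is the interval [y, x] together with the upset of
      x; they share only x, whence the summand 1 in the count below.\<close>
    have "up y = ?A \<union> up x"
      using up_mono[OF x y yx] lin x unfolding up_def by blast
    moreover have "?A \<inter> up x = {x}"
      using dot_antisym x yx by (auto simp: up_def dot_self)
    ultimately have "card ?A + card (up x) = card (up y) + 1"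
      using card_Un_Int[of ?A "up x"] fin fin_up by simp
    moreover have "card ?A = card (up (dot x y))"
      using bij_betw_same_card[OF simple_bij_betw_interval[OF S x y yx]] by (simp add: up_def)
    ultimately show ?thesis
      using card_up x y by simp
  qed
  then show ?thesis
    unfolding l_isomorphic_def A_dot_def using bij f_unit by blast
qed

end

theorem theorem4p14:
  fixes X :: "'a set" and dot :: "'a \<Rightarrow> 'a \<Rightarrow> 'a" and e :: 'a and n :: nat
  assumes "n > 1"
    and "tail_plus_ckl_algebra X dot e"
    and "card X = n"
    and "l_simple X dot e"
  shows "l_linear X dot e \<and> l_isomorphic X dot e (A_carrier n) A_dot 0"
proof -
  interpret tail_plus_ckl_algebra X dot e by fact
  have "finite X" using tail_plus by (simp add: tail_plus_def)
  then show ?thesis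
    using simple_linear finite_simple_isomorphic assms(3,4) by blast
qed

end
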